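(* Let $G$ be a finite abelian group of order $n$, let $g\in G$, and let $i\geq 0$ be an integer. Then \[ M(G, i, g) = \frac{1}{n} \sum_{s \mid \gcd(\exp(G), i)} \binom{n/s+i/s-1}{i/s} \sum_{ d \mid \gcd(s, e(g))} \mu(s/d)\, \# G[d], \] where the sums run over positive divisors.
   Context: For a subset $D$ of $G$, $M(D,i,g)$ denotes the number of multisubsets $M$ of $D$ (multisets whose elements lie in $D$, repetitions allowed) of size $\#M=i$ (counted with multiplicity) whose elements sum to $g$ (counted with multiplicity). $\exp(G)$ is the exponent of $G$; $e(g)=\max\{d : d\mid \exp(G),\ g\in dG\}$; $\mu$ is the Möbius function; $G[d]=\{h\in G : dh=0\}$ is the $d$-torsion subgroup of $G$. *)

theory Defs
  imports Complex_Main "HOL-Algebra.FiniteProduct" "HOL-Algebra.Coset"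
    "HOL-Computational_Algebra.Squarefree" "HOL-Library.Multiset"
begin

text \<open>
  Abelian groups are \<^locale>\<open>comm_group\<close> structures, written multiplicatively: the multiple
  $dh$ is \<open>h [^]\<^bsub>G\<^esub> d\<close> and the neutral element $0$ is \<open>\<one>\<^bsub>G\<^esub>\<close>.
\<close>

definition moebius :: "nat \<Rightarrow> int" where
  "moebius n = (if squarefree n then (-1) ^ card (prime_factors n) else 0)"

definition group_exponent :: "('a, 'b) monoid_scheme \<Rightarrow> nat" where
  "group_exponent G = (LEAST m. 0 < m \<and> (\<forall>x\<in>carrier G. x [^]\<^bsub>G\<^esub> m = \<one>\<^bsub>G\<^esub>))"

definition multiples :: "('a, 'b) monoid_scheme \<Rightarrow> nat \<Rightarrow> 'a set" where
  "multiples G d = (\<lambda>h. h [^]\<^bsub>G\<^esub> d) ` carrier G"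

definition torsion :: "('a, 'b) monoid_scheme \<Rightarrow> nat \<Rightarrow> 'a set" where
  "torsion G d = {h \<in> carrier G. h [^]\<^bsub>G\<^esub> d = \<one>\<^bsub>G\<^esub>}"

text \<open>The set below contains $1$, and it is finite as soon as the exponent is positive.\<close>

definition e_index :: "('a, 'b) monoid_scheme \<Rightarrow> 'a \<Rightarrow> nat" where
  "e_index G g = Max {d. d dvd group_exponent G \<and> g \<in> multiples G d}"

text \<open>The group sum of the elements of a multiset, counted with multiplicity.\<close>

definition mset_total :: "('a, 'b) monoid_scheme \<Rightarrow> 'a multiset \<Rightarrow> 'a" where
  "mset_total G A = finprod G (\<lambda>x. x [^]\<^bsub>G\<^esub> count A x) (set_mset A)"

definition num_multisubsets :: "('a, 'b) monoid_scheme \<Rightarrow> 'a set \<Rightarrow> nat \<Rightarrow> 'a \<Rightarrow> nat" where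
  "num_multisubsets G D i g =
     card {A. set_mset A \<subseteq> D \<and> size A = i \<and> mset_total G A = g}"

end

theory Submission
  imports Defs "HOL-Algebra.Multiplicative_Group"
begin

text \<open>
  Write \<open>M(i, g)\<close> for the number of multisubsets of \<open>G\<close> of size \<open>i\<close> and sum \<open>g\<close>. Double counting the
  elements of these multisets gives \<open>i M(i, g) = (\<Sum>j=1..i. \<Sum>h\<in>G. M(i - j, g - j h))\<close>, which
  determines \<open>M\<close> from \<open>M(0, _)\<close>; it remains to see that the right-hand side satisfies the same recursion.
  Let \<open>N\<^sub>d(g)\<close> be the number of \<open>x\<close> with \<open>d x = g\<close>, which is \<open>#G[d]\<close> or \<open>0\<close>. The inner sum of the
  formula is \<open>c\<^sub>s(g) = (\<Sum>d | d dvd s. \<mu>(s/d) N\<^sub>d(g))\<close>, the sum of \<open>\<chi>(g)\<close> over the characters \<open>\<chi>\<close> of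
  order \<open>s\<close>. Characters are avoided: a unimodular change of variables in \<open>j h + d x = g\<close> gives
  \<open>(\<Sum>h\<in>G. N\<^sub>d(g - j h)) = n N\<^bsub>gcd(d, j)\<^esub>(g)\<close>, and by Moebius cancellation
  \<open>(\<Sum>h\<in>G. c\<^sub>s(g - j h))\<close> is \<open>n c\<^sub>s(g)\<close> if \<open>s dvd j\<close> and \<open>0\<close> otherwise.
\<close>

section \<open>Moebius cancellation over divisors\<close>

lemma moebius_prime_mult:
  assumes "prime p" "squarefree e" "\<not> p dvd e"
  shows "moebius (p * e) = - moebius e"
proof -
  have [simp]: "p \<noteq> 0" "e \<noteq> 0" using assms by (auto intro: Nat.gr0I)
  have "coprime p e" using assms by (simp add: prime_imp_coprime)
  then have sq: "squarefree (p * e)"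
    using assms by (auto intro: squarefree_mult_coprime squarefree_prime)
  have "prime_factors (p * e) = insert p (prime_factors e)"
    using assms by (simp add: prime_factorization_mult prime_factorization_prime)
  moreover have "p \<notin> prime_factors e" using assms by (auto simp: in_prime_factors_iff)
  ultimately show ?thesis using sq assms by (simp add: moebius_def)
qed

text \<open>If \<open>p\<close> divides \<open>s / gcd(s, j)\<close>, the terms of \<open>e = s / d\<close> and \<open>p e\<close> cancel for \<open>e\<close> prime to \<open>p\<close>.\<close>

lemma sum_moebius_gcd_eq_0:
  fixes F :: "nat \<Rightarrow> 'c :: ring_1"
  assumes s: "s > 0" and nd: "\<not> s dvd j"
  shows "(\<Sum>d | d dvd s. of_int (moebius (s div d)) * F (gcd d j)) = 0"
proof -
  have "s div gcd s j \<noteq> 1"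
    using s nd by (metis dvd_div_mult_self gcd_dvd1 gcd_dvd2 mult_1)
  then obtain p where p: "prime p" "p dvd s div gcd s j"
    using prime_factor_nat by blast
  then have pt: "p * gcd s j dvd s"
    by (metis dvd_div_mult_self gcd_dvd1 mult.commute mult_dvd_mono dvd_refl)
  then have ps: "p dvd s" by (metis dvd_mult_left)
  have p0: "p \<noteq> 0" using p by auto
  define f where "f e = of_int (moebius e) * F (gcd (s div e) j)" for e
  let ?A = "{e. e dvd s \<and> squarefree e \<and> \<not> p dvd e}"
  let ?B = "{e. e dvd s \<and> squarefree e \<and> p dvd e}"
  have fin: "finite {e. e dvd s}" using s by simp
  have B: "?B = (*) p ` ?A"
  proof (intro equalityI subsetI)
    fix e assume e: "e \<in> ?B"
    then obtain a where a: "e = p * a" by (auto elim: dvdE)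
    have "\<not> p dvd a"
    proof
      assume "p dvd a"
      then have "p\<^sup>2 dvd e" using a by (simp add: power2_eq_square)
      then show False using e p by (auto simp: squarefree_def)
    qed
    moreover have "squarefree a" "a dvd s"
      using e a by (auto dest: squarefree_multD dvd_mult_right)
    ultimately show "e \<in> (*) p ` ?A" using a by auto
  next
    fix e assume "e \<in> (*) p ` ?A"
    then obtain a where a: "e = p * a" "a dvd s" "squarefree a" "\<not> p dvd a" by auto
    then have "coprime p a" using p by (simp add: prime_imp_coprime)
    then show "e \<in> ?B" using a p ps
      by (auto intro: divides_mult squarefree_mult_coprime squarefree_prime)
  qed
  have pair: "f (p * e) = - f e" if e: "e \<in> ?A" for e
  proof -
    have "p * e dvd s" using B e by blast
    then obtain a where a: "s = p * e * a" by (auto elim: dvdE)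
    have e0: "e \<noteq> 0" using s a by auto
    have "coprime p e" using p e by (simp add: prime_imp_coprime)
    \<comment> \<open>This gcd divides \<open>gcd s j\<close>, so \<open>p\<close> times it divides
      \<open>s = p * e * a\<close>. Hence it divides \<open>e * a\<close> as well as
      \<open>p * a\<close>, and therefore \<open>a\<close>, because \<open>p\<close> and
      \<open>e\<close> are coprime.\<close>
    have "gcd (p * a) j = gcd a j"
    proof (rule dvd_antisym)
      let ?q = "gcd (p * a) j"
      have "?q dvd s" unfolding a by (rule dvd_trans[OF gcd_dvd1]) (simp add: ac_simps)
      then have "p * ?q dvd s" using pt by (meson dvd_refl dvd_trans gcd_dvd2 gcd_greatest mult_dvd_mono)
      then have "?q dvd e * a" using a p0 by (simp add: mult.assoc)
      moreover have "?q dvd p * a" by simp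
      ultimately have "?q dvd gcd (p * a) (e * a)" by simp
      also have "gcd (p * a) (e * a) = gcd p e * a" by (metis gcd_mult_distrib_nat mult.commute)
      finally have "?q dvd a" using \<open>coprime p e\<close> by simp
      then show "?q dvd gcd a j" by simp
    qed (auto intro: gcd_greatest dvd_trans[OF gcd_dvd1])
    moreover have "s div (p * e) = a" "s div e = p * a"
      using a e0 p0 by (auto simp: mult.assoc mult.left_commute)
    ultimately show ?thesis
      using e p by (simp add: f_def moebius_prime_mult)
  qed
  have "(\<Sum>d | d dvd s. of_int (moebius (s div d)) * F (gcd d j)) = (\<Sum>e | e dvd s. f e)"
    using s unfolding f_def
    by (intro sum.reindex_bij_witness[of _ "\<lambda>e. s div e" "\<lambda>d. s div d"]) 
       (auto simp: div_div_eq_right)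
  also have "\<dots> = (\<Sum>e \<in> ?A \<union> ?B. f e)"
    using fin by (intro sum.mono_neutral_right) (auto simp: f_def moebius_def)
  also have "\<dots> = sum f ?A + sum f ?B"
    using fin by (intro sum.union_disjoint) auto
  also have "sum f ?B = (\<Sum>e\<in>?A. f (p * e))"
    unfolding B using p0 by (subst sum.reindex) (auto simp: inj_on_def)
  also have "\<dots> = (\<Sum>e\<in>?A. - f e)" using pair by (intro sum.cong) auto
  finally show ?thesis by (simp add: sum_negf)
qed

text \<open>By the hockey-stick identity the sum is \<open>(N + m - 1) choose (m - 1)\<close>;
  absorption then trades the factor \<open>N\<close> for \<open>m\<close>. With
  \<open>N = n / s\<close> and \<open>m = i / s\<close> this is the recursion behind the binomials
  of the formula.\<close>

lemma sum_diagonal_binomial: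
  assumes "N > 0"
  shows "N * (\<Sum>k<m. (N + k - 1) choose k) = m * ((N + m - 1) choose m)"
proof (induction m)
  case (Suc m)
  obtain a where a: "N = Suc a" using assms gr0_implies_Suc by blast
  show ?case using Suc Suc_times_binomial_eq[of "a + m" m]
    by (simp add: a algebra_simps)
qed simp

section \<open>Counting solutions of power equations\<close>

context comm_group
begin

text \<open>One row of a product of two 2 by 2 exponent matrices; it serves to check that two
  changes of variables are mutually inverse.\<close>

lemma int_pow_lincomb:
  fixes p q r t a b :: int
  assumes "h \<in> carrier G" "x \<in> carrier G"
  shows "(h [^] p \<otimes> x [^] q) [^] a \<otimes> (h [^] r \<otimes> x [^] t) [^] b
     = h [^] (p * a + r * b) \<otimes> x [^] (q * a + t * b)"
  using assms by (simp add: int_pow_mult_distrib m_comm int_pow_pow int_pow_mult m_ac)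

definition num_roots :: "nat \<Rightarrow> 'a \<Rightarrow> nat" where
  "num_roots d g = card {x \<in> carrier G. x [^] d = g}"

text \<open>In suitable coordinates \<open>(y, z)\<close> the equation reads
  \<open>y [^] gcd d j = g\<close> and leaves \<open>z\<close> free, which accounts for the factor
  \<open>order G\<close>.\<close>

lemma card_pow_pairs:
  fixes j d :: nat
  assumes "finite (carrier G)" and "0 < d"
  shows "card {(h, x). h \<in> carrier G \<and> x \<in> carrier G \<and> h [^] j \<otimes> x [^] d = g}
    = order G * num_roots (gcd d j) g"
proof -
  define k where "k = int (gcd d j)"
  have k0: "k > 0" using assms by (simp add: k_def)
  have kd: "k dvd int d" "k dvd int j" by (auto simp: k_def)
  then obtain d' j' where dj: "int d = d' * k" "int j = j' * k" by (metis dvd_def mult.commute)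
  obtain u v where "u * int j + v * int d = gcd (int j) (int d)"
    using bezout_int by blast
  also have "gcd (int j) (int d) = k" by (simp add: k_def gcd.commute)
  finally have "u * (j' * k) + v * (d' * k) = k" unfolding dj .
  moreover have "(u * j' + v * d') * k = u * (j' * k) + v * (d' * k)" by (simp add: distrib_right)
  ultimately have "(u * j' + v * d') * k = 1 * k" by (simp only: mult_1)
  then have uv: "u * j' + v * d' = 1" using k0 by (metis mult_cancel_right less_irrefl)
  let ?S = "{(h, x). h \<in> carrier G \<and> x \<in> carrier G \<and> h [^] j \<otimes> x [^] d = g}"
  let ?T = "{y \<in> carrier G. y [^] gcd d j = g} \<times> carrier G"
  \<comment> \<open>The exponent matrix has rows \<open>(j', d')\<close> and
    \<open>(- v, u)\<close>, so its determinant is \<open>u * j' + v * d' = 1\<close>;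
    \<open>?g\<close> uses the inverse matrix. Bezout coefficients may be negative, hence integer
    powers.\<close>
  let ?f = "\<lambda>(h, x). (h [^] j' \<otimes> x [^] d', h [^] (- v) \<otimes> x [^] u)"
  let ?g = "\<lambda>(y, z). (y [^] u \<otimes> z [^] (- d'), y [^] v \<otimes> z [^] j')"
  \<comment> \<open>With \<open>uv\<close>, these are the entries of both matrix products, in the
    shape in which \<open>int_pow_lincomb\<close> produces them.\<close>
  have uv': "j' * u + - v * - d' = 1" "d' * u + u * - d' = 0" "j' * v + - v * j' = 0"
    "d' * v + u * j' = 1" "- d' * j' + j' * d' = 0" "u * - v + v * u = 0" "- d' * - v + j' * u = 1"
    using uv by (simp_all add: mult.commute add.commute)
  have fg: "?g (?f (h, x)) = (h, x)" if "h \<in> carrier G" "x \<in> carrier G" for h x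
    unfolding prod.case int_pow_lincomb[OF that] uv' using that by simp
  have gf: "?f (?g (y, z)) = (y, z)" if "y \<in> carrier G" "z \<in> carrier G" for y z
    unfolding prod.case int_pow_lincomb[OF that] uv uv' using that by simp
  have pw: "h [^] j \<otimes> x [^] d = (h [^] j' \<otimes> x [^] d') [^] gcd d j"
    if "h \<in> carrier G" "x \<in> carrier G" for h x
  proof -
    have "h [^] j \<otimes> x [^] d = h [^] (int j) \<otimes> x [^] (int d)" by (simp add: int_pow_int)
    also have "\<dots> = (h [^] j' \<otimes> x [^] d') [^] k"
      using that dj by (simp add: int_pow_mult_distrib m_comm int_pow_pow)
    finally show ?thesis by (simp add: k_def int_pow_int)
  qed
  have "bij_betw ?f ?S ?T"
  proof (rule bij_betw_byWitness[where f' = ?g])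
    show "\<forall>a\<in>?S. ?g (?f a) = a" using fg by auto
    show "\<forall>a\<in>?T. ?f (?g a) = a" using gf by auto
    show "?f ` ?S \<subseteq> ?T" using pw by auto
    show "?g ` ?T \<subseteq> ?S"
    proof
      fix b assume "b \<in> ?g ` ?T"
      then obtain y z where yz: "y \<in> carrier G" "z \<in> carrier G" "y [^] gcd d j = g" "b = ?g (y, z)"
        by auto
      then show "b \<in> ?S" using gf[of y z] pw[of "fst b" "snd b"] by auto
    qed
  qed
  then have "card ?S = card ?T" by (rule bij_betw_same_card)
  then show ?thesis by (simp add: card_cartesian_product num_roots_def order_def)
qed

text \<open>The pairs of \<open>card_pow_pairs\<close> are counted fibrewise over
  \<open>h\<close>.\<close>

lemma sum_num_roots_shift:
  fixes j d :: nat
  assumes "finite (carrier G)" "0 < d" "g \<in> carrier G"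
  shows "(\<Sum>h\<in>carrier G. num_roots d (g \<otimes> inv (h [^] j))) = order G * num_roots (gcd d j) g"
proof -
  have eq: "x [^] d = g \<otimes> inv (h [^] j) \<longleftrightarrow> h [^] j \<otimes> x [^] d = g"
    if "h \<in> carrier G" "x \<in> carrier G" for h x
    using that assms by (metis inv_solve_right m_comm nat_pow_closed)
  have "{(h, x). h \<in> carrier G \<and> x \<in> carrier G \<and> h [^] j \<otimes> x [^] d = g}
    = (SIGMA h : carrier G. {x \<in> carrier G. x [^] d = g \<otimes> inv (h [^] j)})"
    using eq by auto
  then show ?thesis
    using card_pow_pairs[OF assms(1,2), of j g] assms by (simp add: num_roots_def)
qed

text \<open>A nonempty solution set is a coset of the torsion subgroup.\<close>

lemma num_roots_eq:
  assumes "g \<in> carrier G"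
  shows "num_roots d g = (if g \<in> multiples G d then card (torsion G d) else 0)"
proof (cases "g \<in> multiples G d")
  case True
  then obtain y where y: "y \<in> carrier G" "g = y [^] d" by (auto simp: multiples_def)
  have "bij_betw (\<lambda>x. y \<otimes> x) (torsion G d) {x \<in> carrier G. x [^] d = g}"
  proof (rule bij_betw_byWitness[where f' = "\<lambda>x. inv y \<otimes> x"])
    have "inv y \<otimes> (y \<otimes> x) = x" "y \<otimes> (inv y \<otimes> x) = x" if "x \<in> carrier G" for x
      using that y by (simp_all flip: m_assoc)
    then show "\<forall>x\<in>torsion G d. inv y \<otimes> (y \<otimes> x) = x"
      "\<forall>x\<in>{x \<in> carrier G. x [^] d = g}. y \<otimes> (inv y \<otimes> x) = x"
      by (auto simp: torsion_def)
    have dist: "(a \<otimes> b) [^] d = a [^] d \<otimes> b [^] d" if "a \<in> carrier G" "b \<in> carrier G" for a b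
      using that by (intro pow_mult_distrib m_comm)
    show "(\<otimes>) y ` torsion G d \<subseteq> {x \<in> carrier G. x [^] d = g}"
      using y by (auto simp: torsion_def dist)
    show "(\<otimes>) (inv y) ` {x \<in> carrier G. x [^] d = g} \<subseteq> torsion G d"
      using y by (auto simp: torsion_def dist nat_pow_inv)
  qed
  then show ?thesis using True by (simp add: num_roots_def bij_betw_same_card)
next
  case False
  then have "{x \<in> carrier G. x [^] d = g} = {}" by (auto simp: multiples_def)
  then show ?thesis using False unfolding num_roots_def by (simp only: card.empty if_False)
qed

section \<open>Ramanujan sums on the group\<close>

text \<open>For cyclic \<open>G\<close> and \<open>s\<close> dividing its order, this is the classical Ramanujan sum.\<close>

definition ramanujan_sum :: "nat \<Rightarrow> 'a \<Rightarrow> real" where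
  "ramanujan_sum s g = (\<Sum>d | d dvd s. real_of_int (moebius (s div d)) * real (num_roots d g))"

text \<open>In terms of characters this is orthogonality: the \<open>j\<close>-th power of a
  character of order \<open>s\<close> is trivial exactly if \<open>s dvd j\<close>.\<close>

lemma sum_ramanujan_sum_shift:
  assumes "finite (carrier G)" "0 < s" "g \<in> carrier G"
  shows "(\<Sum>h\<in>carrier G. ramanujan_sum s (g \<otimes> inv (h [^] (j::nat))))
    = (if s dvd j then real (order G) * ramanujan_sum s g else 0)"
proof -
  have pos: "0 < d" if "d dvd s" for d using that assms by (auto intro: Nat.gr0I)
  have "(\<Sum>h\<in>carrier G. ramanujan_sum s (g \<otimes> inv (h [^] j)))
    = (\<Sum>d | d dvd s. real_of_int (moebius (s div d)) *
        real (\<Sum>h\<in>carrier G. num_roots d (g \<otimes> inv (h [^] j))))"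
    unfolding ramanujan_sum_def by (subst sum.swap) (simp add: sum_distrib_left)
  also have "\<dots> = real (order G) *
      (\<Sum>d | d dvd s. real_of_int (moebius (s div d)) * real (num_roots (gcd d j) g))"
    unfolding sum_distrib_left
    by (intro sum.cong refl) (simp add: sum_num_roots_shift pos assms flip: of_nat_sum)
  also have "\<dots> = (if s dvd j then real (order G) * ramanujan_sum s g else 0)"
  proof (cases "s dvd j")
    case True
    then have "gcd d j = d" if "d dvd s" for d using that by (meson dvd_trans gcd_nat.absorb1)
    then show ?thesis using True by (simp add: ramanujan_sum_def)
  next
    case False
    then show ?thesis
      using sum_moebius_gcd_eq_0[of s j "\<lambda>k. real (num_roots k g)"] assms by simp
  qed
  finally show ?thesis .
qed

text \<open>Moebius inversion of the definition; it settles the case of the empty multiset.\<close>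

lemma sum_ramanujan_sum:
  assumes "0 < m"
  shows "(\<Sum>s | s dvd m. ramanujan_sum s g) = real (num_roots m g)"
proof -
  have fin: "finite {d. d dvd m}" using assms by simp
  have "(\<Sum>s | s dvd m. ramanujan_sum s g) =
    (\<Sum>s | s dvd m. \<Sum>d | d dvd m \<and> d dvd s. real_of_int (moebius (s div d)) * real (num_roots d g))"
    unfolding ramanujan_sum_def by (intro sum.cong) (auto intro: dvd_trans)
  also have "\<dots> = (\<Sum>d | d dvd m. \<Sum>s | s dvd m \<and> d dvd s.
      real_of_int (moebius (s div d)) * real (num_roots d g))"
    using sum.swap_restrict[OF fin fin] by simp
  also have "\<dots> = (\<Sum>d | d dvd m. if d = m then real (num_roots d g) else 0)"
  proof (intro sum.cong refl)
    fix d assume "d \<in> {d. d dvd m}"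
    then obtain c where c: "m = d * c" by (auto elim: dvdE)
    then have pos: "0 < d" "0 < c" using assms by auto
    have "(\<Sum>s | s dvd m \<and> d dvd s. real_of_int (moebius (s div d)) * real (num_roots d g))
      = (\<Sum>e | e dvd c. real_of_int (moebius (c div e)) * real (num_roots d g))"
    proof (intro sum.reindex_bij_witness[of _ "\<lambda>e. d * (c div e)" "\<lambda>s. c div (s div d)"])
      fix s assume "s \<in> {s. s dvd m \<and> d dvd s}"
      then obtain q where q: "s = d * q" "q dvd c" using c pos by (auto elim: dvdE)
      then obtain r where r: "c = q * r" by (auto elim: dvdE)
      show "d * (c div (c div (s div d))) = s" "c div (s div d) \<in> {e. e dvd c}"
        "real_of_int (moebius (c div (c div (s div d)))) * real (num_roots d g)
          = real_of_int (moebius (s div d)) * real (num_roots d g)"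
        using pos q r by auto
    next
      fix e assume "e \<in> {e. e dvd c}"
      then obtain r where r: "c = e * r" by (auto elim: dvdE)
      show "c div (d * (c div e) div d) = e" "d * (c div e) \<in> {s. s dvd m \<and> d dvd s}"
        using pos c r by auto
    qed
    also have "\<dots> = (if d = m then real (num_roots d g) else 0)"
    proof (cases "c = 1")
      case True
      then show ?thesis using c by (simp add: moebius_def)
    next
      case False
      then show ?thesis
        \<comment> \<open>A constant function and \<open>j = 1\<close> turn the cancellation into
          the vanishing of the Moebius sum over the divisors of \<open>c\<close>, for
          \<open>c\<close> other than 1.\<close>
        using sum_moebius_gcd_eq_0[of c 1 "\<lambda>_. real (num_roots d g)"] pos c by simp
    qed
    finally show "(\<Sum>s | s dvd m \<and> d dvd s. real_of_int (moebius (s div d)) * real (num_roots d g))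
      = (if d = m then real (num_roots d g) else 0)" .
  qed
  also have "\<dots> = real (num_roots m g)" using fin by (simp add: sum.delta)
  finally show ?thesis .
qed

section \<open>The exponent and the index \<open>e(g)\<close>\<close>

lemma group_exponent_props:
  assumes "finite (carrier G)"
  shows group_exponent_pos: "0 < group_exponent G"
    and pow_group_exponent: "\<And>x. x \<in> carrier G \<Longrightarrow> x [^] group_exponent G = \<one>"
    and group_exponent_dvd_order: "group_exponent G dvd order G"
proof -
  let ?P = "\<lambda>m. 0 < m \<and> (\<forall>x\<in>carrier G. x [^] m = \<one>)"
  let ?m = "group_exponent G"
  have n: "?P (order G)" using assms by (simp add: pow_order_eq_1 order_gt_0_iff_finite)
  then have m: "?P ?m" unfolding group_exponent_def by (rule LeastI)
  then show "0 < ?m" "\<And>x. x \<in> carrier G \<Longrightarrow> x [^] ?m = \<one>" by auto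
  \<comment> \<open>A nonzero remainder would be a smaller positive number annihilating the group,
    against the minimality of \<open>?m\<close>.\<close>
  have "x [^] (order G mod ?m) = \<one>" if x: "x \<in> carrier G" for x
  proof -
    have "x [^] order G = x [^] (?m * (order G div ?m)) \<otimes> x [^] (order G mod ?m)"
      using x by (simp add: nat_pow_mult)
    also have "x [^] (?m * (order G div ?m)) = \<one>"
      using x m by (simp flip: nat_pow_pow)
    finally show ?thesis using x n by simp
  qed
  then have "\<not> 0 < order G mod ?m"
    using not_less_Least[of "order G mod ?m" ?P] m by (auto simp flip: group_exponent_def)
  then show "?m dvd order G" by auto
qed

lemma multiples_dvd:
  assumes "g \<in> multiples G b" "a dvd b"
  shows "g \<in> multiples G a"
proof -
  obtain c where c: "b = c * a" using assms by (metis dvdE mult.commute)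
  obtain x where "x \<in> carrier G" "g = x [^] b" using assms by (auto simp: multiples_def)
  then have "g = (x [^] c) [^] a" "x [^] c \<in> carrier G" using c by (simp_all add: nat_pow_pow)
  then show ?thesis unfolding multiples_def by blast
qed

text \<open>Additively, let \<open>g = a x = b y\<close> and \<open>u a' + v b' = 1\<close>, where
  \<open>a'\<close> and \<open>b'\<close> are \<open>a\<close> and \<open>b\<close> divided by their
  gcd. Both \<open>b' a\<close> and \<open>a' b\<close> equal the lcm, so
  \<open>g = v b' g + u a' g\<close> is the lcm times \<open>v x + u y\<close>.\<close>

lemma multiples_lcm:
  assumes "g \<in> multiples G a" "g \<in> multiples G b" and a0: "0 < a"
  shows "g \<in> multiples G (lcm a b)"
proof -
  define c where "c = gcd a b"
  have c0: "c > 0" using a0 by (simp add: c_def)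
  obtain a' b' where ab: "a = a' * c" "b = b' * c" unfolding c_def
    by (metis dvd_def gcd_dvd1 gcd_dvd2 mult.commute)
  have "c * lcm a b = a * b" unfolding c_def by (rule prod_gcd_lcm_nat[symmetric])
  also have "\<dots> = c * (a' * b' * c)" by (simp only: ab ac_simps)
  finally have L: "lcm a b = a' * b' * c" using c0 by simp
  obtain u v where "u * int a + v * int b = gcd (int a) (int b)"
    using bezout_int by blast
  also have "gcd (int a) (int b) = int c" by (simp add: c_def)
  finally have "(u * int a' + v * int b') * int c = 1 * int c"
    unfolding ab by (simp add: distrib_right mult.assoc)
  then have uv: "u * int a' + v * int b' = 1" using c0 by (metis mult_cancel_right less_irrefl of_nat_0_less_iff)
  obtain x y where x: "x \<in> carrier G" "g = x [^] a" and y: "y \<in> carrier G" "g = y [^] b"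
    using assms by (auto simp: multiples_def)
  have g: "g \<in> carrier G" using x by simp
  have gx: "g = x [^] int a" and gy: "g = y [^] int b" using x y by (simp_all add: int_pow_int)
  have "g = g [^] (v * int b' + u * int a')" using uv g by (simp add: add.commute)
  also have "\<dots> = g [^] (v * int b') \<otimes> g [^] (u * int a')" using g by (simp add: int_pow_mult)
  also have "g [^] (v * int b') = x [^] (int a * (v * int b'))"
    using x by (subst gx) (simp add: int_pow_pow)
  also have "int a * (v * int b') = v * int (lcm a b)" unfolding L by (simp add: ab ac_simps)
  also have "g [^] (u * int a') = y [^] (int b * (u * int a'))"
    using y by (subst gy) (simp add: int_pow_pow)
  also have "int b * (u * int a') = u * int (lcm a b)" unfolding L by (simp add: ab ac_simps)
  also have "x [^] (v * int (lcm a b)) \<otimes> y [^] (u * int (lcm a b)) = (x [^] v \<otimes> y [^] u) [^] int (lcm a b)"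
    using x y by (simp add: int_pow_mult_distrib m_comm int_pow_pow)
  finally have "g = (x [^] v \<otimes> y [^] u) [^] lcm a b" by (simp add: int_pow_int)
  then show ?thesis using x y unfolding multiples_def by blast
qed

text \<open>The set under the maximum is closed under lcm, so its largest element is also largest
  for divisibility.\<close>

lemma dvd_e_index_iff:
  assumes "finite (carrier G)" "g \<in> carrier G"
  shows "d dvd e_index G g \<longleftrightarrow> d dvd group_exponent G \<and> g \<in> multiples G d"
proof -
  let ?S = "{d. d dvd group_exponent G \<and> g \<in> multiples G d}"
  have exp: "0 < group_exponent G" using assms by (simp add: group_exponent_pos)
  then have fin: "finite ?S" by simp
  have "g = g [^] (1::nat)" using assms by simp
  then have "1 \<in> ?S" using assms by (auto simp: multiples_def)
  then have e: "e_index G g \<in> ?S" unfolding e_index_def using fin by (intro Max_in) auto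
  show ?thesis
  proof
    assume "d dvd e_index G g"
    then show "d dvd group_exponent G \<and> g \<in> multiples G d"
      using e by (auto intro: dvd_trans multiples_dvd)
  next
    assume d: "d dvd group_exponent G \<and> g \<in> multiples G d"
    have e0: "0 < e_index G g" using e exp by (auto intro: Nat.gr0I)
    have "lcm (e_index G g) d \<in> ?S" using d e e0 by (auto intro: multiples_lcm)
    then have "lcm (e_index G g) d \<le> e_index G g"
      unfolding e_index_def using fin by (intro Max_ge)
    moreover have "lcm (e_index G g) d > 0" using e0 d exp by (auto simp: lcm_pos_nat intro: Nat.gr0I)
    ultimately show "d dvd e_index G g"
      by (metis dvd_imp_le dvd_lcm1 dvd_lcm2 le_antisym)
  qed
qed

text \<open>Divisors \<open>d\<close> of \<open>s\<close> with \<open>g\<close> outside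
  \<open>multiples G d\<close> contribute 0; \<open>dvd_e_index_iff\<close> identifies the remaining
  ones.\<close>

lemma ramanujan_sum_eq:
  assumes "finite (carrier G)" "g \<in> carrier G" "s dvd group_exponent G"
  shows "ramanujan_sum s g =
    (\<Sum>d | d dvd gcd s (e_index G g). real_of_int (moebius (s div d)) * real (card (torsion G d)))"
proof -
  have s0: "0 < s" using assms group_exponent_pos by (auto intro: Nat.gr0I)
  have "{d. d dvd gcd s (e_index G g)} = {d. d dvd s \<and> g \<in> multiples G d}"
    using assms by (auto simp: dvd_e_index_iff intro: dvd_trans)
  then show ?thesis unfolding ramanujan_sum_def using s0 assms(2)
    by (intro sum.mono_neutral_cong_right) (auto simp: num_roots_eq)
qed

section \<open>The recursion for the number of multisubsets\<close>

text \<open>An index set independent of \<open>A\<close> allows totals to be compared factor by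
  factor.\<close>

lemma mset_total_eq:
  assumes "finite (carrier G)" "set_mset A \<subseteq> carrier G"
  shows "mset_total G A = (\<Otimes>x\<in>carrier G. x [^] count A x)"
  unfolding mset_total_def using assms
  by (intro finprod_mono_neutral_cong_left) (auto simp: not_in_iff)

lemma mset_total_closed:
  "set_mset A \<subseteq> carrier G \<Longrightarrow> mset_total G A \<in> carrier G"
  unfolding mset_total_def by (intro finprod_closed) auto

lemma mset_total_plus_replicate:
  assumes "finite (carrier G)" "set_mset A \<subseteq> carrier G" "h \<in> carrier G"
  shows "mset_total G (A + replicate_mset j h) = mset_total G A \<otimes> h [^] j"
proof -
  have "mset_total G (A + replicate_mset j h)
      = (\<Otimes>x\<in>carrier G. x [^] count (A + replicate_mset j h) x)"
    using assms by (intro mset_total_eq) (auto split: if_splits)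
  also have "\<dots> = (\<Otimes>x\<in>carrier G. x [^] count A x \<otimes> (if h = x then x [^] j else \<one>))"
    by (intro finprod_cong') (auto simp: nat_pow_mult)
  also have "\<dots> = mset_total G A \<otimes> h [^] j"
    using assms by (subst finprod_multf) (auto simp: mset_total_eq finprod_singleton)
  finally show ?thesis .
qed

lemma finite_multisubsets:
  assumes "finite D"
  shows "finite {A. set_mset A \<subseteq> D \<and> size A = i \<and> P A}"
  using finite_multisets_of_size[OF assms, of i]
  by (rule rev_finite_subset) (auto simp: multisets_of_size_def)

lemma card_multisubsets_count_ge:
  assumes "finite (carrier G)" "g \<in> carrier G" "h \<in> carrier G" "j \<le> i"
  shows "card {A. set_mset A \<subseteq> carrier G \<and> size A = i \<and> mset_total G A = g \<and> j \<le> count A h}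
    = num_multisubsets G (carrier G) (i - j) (g \<otimes> inv (h [^] j))"
  (is "card ?S = _")
proof -
  let ?T = "{A. set_mset A \<subseteq> carrier G \<and> size A = i - j \<and> mset_total G A = g \<otimes> inv (h [^] j)}"
  have tot: "mset_total G (A + replicate_mset j h) = g \<longleftrightarrow> mset_total G A = g \<otimes> inv (h [^] j)"
    if "set_mset A \<subseteq> carrier G" for A
    using that assms mset_total_closed[OF that]
    by (metis inv_solve_right mset_total_plus_replicate nat_pow_closed)
  have "bij_betw (\<lambda>A. A + replicate_mset j h) ?T ?S"
  proof (rule bij_betw_byWitness[where f' = "\<lambda>A. A - replicate_mset j h"])
    show "\<forall>A\<in>?S. A - replicate_mset j h + replicate_mset j h = A"
      by (auto simp: count_le_replicate_mset_subset_eq)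
    show "(\<lambda>A. A + replicate_mset j h) ` ?T \<subseteq> ?S"
      using assms tot by (auto split: if_splits)
    show "(\<lambda>A. A - replicate_mset j h) ` ?S \<subseteq> ?T"
    proof
      fix B assume "B \<in> (\<lambda>A. A - replicate_mset j h) ` ?S"
      then obtain A where A: "A \<in> ?S" "B = A - replicate_mset j h" by auto
      then have AB: "A = B + replicate_mset j h"
        by (simp add: count_le_replicate_mset_subset_eq)
      then show "B \<in> ?T" using A(1) tot[of B] by auto
    qed
  qed auto
  then show ?thesis by (simp add: num_multisubsets_def bij_betw_same_card)
qed

text \<open>Counting triples of a multisubset \<open>A\<close>, an element \<open>h\<close> and some \<open>j\<close> with
  \<open>1 \<le> j \<le> count A h\<close>, either by \<open>A\<close> or by \<open>A\<close> with \<open>j\<close> copies of \<open>h\<close> removed.\<close>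

lemma num_multisubsets_rec:
  assumes "finite (carrier G)" "g \<in> carrier G"
  shows "i * num_multisubsets G (carrier G) i g =
    (\<Sum>j\<in>{1..i}. \<Sum>h\<in>carrier G. num_multisubsets G (carrier G) (i - j) (g \<otimes> inv (h [^] j)))"
proof -
  let ?S = "{A. set_mset A \<subseteq> carrier G \<and> size A = i \<and> mset_total G A = g}"
  have fin: "finite ?S" using assms by (intro finite_multisubsets)
  have size: "i = (\<Sum>h\<in>carrier G. \<Sum>j\<in>{1..i}. if j \<le> count A h then 1 else 0)" if A: "A \<in> ?S" for A
  proof -
    have "(\<Sum>j\<in>{1..i}. if j \<le> count A h then 1 else 0) = count A h" for h
    proof -
      \<comment> \<open>The cutoff \<open>j \<le> i\<close> thus loses none of the
        \<open>count A h\<close> values of \<open>j\<close>.\<close>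
      have "count A h \<le> i" using A count_le_size[of A h] by auto
      then have "{1..i} \<inter> {j. j \<le> count A h} = {1..count A h}" by auto
      then show ?thesis by (simp add: sum.If_cases)
    qed
    moreover have "i = (\<Sum>h\<in>carrier G. count A h)"
      using A assms by (auto simp: size_multiset_overloaded_eq not_in_iff intro!: sum.mono_neutral_left)
    ultimately show ?thesis by simp
  qed
  have "i * num_multisubsets G (carrier G) i g = (\<Sum>A\<in>?S. i)"
    by (simp add: num_multisubsets_def)
  also have "\<dots> = (\<Sum>A\<in>?S. \<Sum>h\<in>carrier G. \<Sum>j\<in>{1..i}. if j \<le> count A h then 1 else 0)"
    using size by (intro sum.cong) auto
  also have "\<dots> = (\<Sum>h\<in>carrier G. \<Sum>j\<in>{1..i}. \<Sum>A\<in>?S. if j \<le> count A h then 1 else 0)"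
    by (subst sum.swap, intro sum.cong refl, rule sum.swap)
  also have "\<dots> = (\<Sum>j\<in>{1..i}. \<Sum>h\<in>carrier G. \<Sum>A\<in>?S. if j \<le> count A h then 1 else 0)"
    by (rule sum.swap)
  also have "\<dots> = (\<Sum>j\<in>{1..i}. \<Sum>h\<in>carrier G.
      num_multisubsets G (carrier G) (i - j) (g \<otimes> inv (h [^] j)))"
  proof (intro sum.cong refl)
    fix j h assume "j \<in> {1..i}" "h \<in> carrier G"
    moreover have "?S \<inter> {A. j \<le> count A h} =
      {A. set_mset A \<subseteq> carrier G \<and> size A = i \<and> mset_total G A = g \<and> j \<le> count A h}" by auto
    ultimately show "(\<Sum>A\<in>?S. if j \<le> count A h then 1 else 0) =
      num_multisubsets G (carrier G) (i - j) (g \<otimes> inv (h [^] j))"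
      using assms fin card_multisubsets_count_ge[of g h j i] by (simp add: sum.If_cases)
  qed
  finally show ?thesis .
qed

section \<open>The recursion for the formula and the conclusion\<close>

text \<open>The right-hand side of the theorem without the factor \<open>1 / n\<close>.\<close>

definition multiset_formula :: "nat \<Rightarrow> 'a \<Rightarrow> real" where
  "multiset_formula i g = (\<Sum>s | s dvd group_exponent G \<and> s dvd i.
     real ((order G div s + i div s - 1) choose (i div s)) * ramanujan_sum s g)"

text \<open>Summation over \<open>h\<close> leaves only those \<open>s\<close> that divide both
  \<open>j\<close> and \<open>i - j\<close>, hence \<open>i\<close>; for each of them the sum over
  \<open>j\<close> is a diagonal binomial sum.\<close>

lemma multiset_formula_rec:
  assumes fin: "finite (carrier G)" and g: "g \<in> carrier G"
  shows "real i * multiset_formula i g =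
    (\<Sum>j\<in>{1..i}. \<Sum>h\<in>carrier G. multiset_formula (i - j) (g \<otimes> inv (h [^] j)))"
proof -
  let ?E = "{s. s dvd group_exponent G}"
  let ?b = "\<lambda>s k. real ((order G div s + k div s - 1) choose (k div s))"
  have finE: "finite ?E" using group_exponent_pos[OF fin] by simp
  have pos: "0 < s" if "s \<in> ?E" for s
    using that group_exponent_pos[OF fin] by (auto intro: Nat.gr0I)
  \<comment> \<open>Moving \<open>s dvd k\<close> into the summand gives all values of
    \<open>k\<close> the same index set, so that the sums can be interchanged.\<close>
  have mf: "multiset_formula k x = (\<Sum>s\<in>?E. if s dvd k then ?b s k * ramanujan_sum s x else 0)" for k x
    unfolding multiset_formula_def using finE
    by (simp add: sum.inter_filter[symmetric])
  have "(\<Sum>j\<in>{1..i}. \<Sum>h\<in>carrier G. multiset_formula (i - j) (g \<otimes> inv (h [^] j)))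
    = (\<Sum>j\<in>{1..i}. \<Sum>s\<in>?E. if s dvd i - j then ?b s (i - j) *
         (\<Sum>h\<in>carrier G. ramanujan_sum s (g \<otimes> inv (h [^] j))) else 0)"
    unfolding mf by (intro sum.cong refl, subst sum.swap) (auto simp: sum_distrib_left intro!: sum.cong)
  also have "\<dots> = (\<Sum>j\<in>{1..i}. \<Sum>s\<in>?E. if s dvd i - j \<and> s dvd j
      then ?b s (i - j) * (real (order G) * ramanujan_sum s g) else 0)"
    using pos by (intro sum.cong refl) (auto simp: sum_ramanujan_sum_shift fin g)
  also have "\<dots> = (\<Sum>s\<in>?E. \<Sum>j\<in>{1..i}. if s dvd i - j \<and> s dvd j
      then ?b s (i - j) * (real (order G) * ramanujan_sum s g) else 0)"
    by (rule sum.swap)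
  also have "\<dots> = (\<Sum>s\<in>?E. if s dvd i then real i * (?b s i * ramanujan_sum s g) else 0)"
  proof (intro sum.cong refl)
    fix s assume s: "s \<in> ?E"
    show "(\<Sum>j\<in>{1..i}. if s dvd i - j \<and> s dvd j
        then ?b s (i - j) * (real (order G) * ramanujan_sum s g) else 0)
      = (if s dvd i then real i * (?b s i * ramanujan_sum s g) else 0)"
    proof (cases "s dvd i")
      case False
      then have "\<not> (s dvd i - j \<and> s dvd j)" if "j \<in> {1..i}" for j
        using that by (metis atLeastAtMost_iff dvd_diffD)
      then show ?thesis using False by (auto intro!: sum.neutral)
    next
      case True
      then obtain m where m: "i = s * m" by (auto elim: dvdE)
      have "s dvd order G" using s group_exponent_dvd_order[OF fin] by (auto intro: dvd_trans)
      then obtain N where N: "order G = s * N" by (auto elim: dvdE)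
      have N0: "N > 0" using N fin order_gt_0_iff_finite by (auto intro: Nat.gr0I)
      have "(\<Sum>j\<in>{1..i}. if s dvd i - j \<and> s dvd j
          then ?b s (i - j) * (real (order G) * ramanujan_sum s g) else 0)
        = (\<Sum>j\<in>{j \<in> {1..i}. s dvd i - j \<and> s dvd j}. ?b s (i - j) * (real (order G) * ramanujan_sum s g))"
        by (rule sum.inter_filter[symmetric]) simp
      \<comment> \<open>The new index is \<open>k = (i - j) / s\<close>; since \<open>j\<close> is a
        positive multiple of \<open>s\<close>, it stays below \<open>m\<close>.\<close>
      also have "\<dots> = (\<Sum>k<m. real ((N + k - 1) choose k) * (real (order G) * ramanujan_sum s g))"
      proof (intro sum.reindex_bij_witness[of _ "\<lambda>k. s * (m - k)" "\<lambda>j. m - j div s"])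
        fix j assume j: "j \<in> {j \<in> {1..i}. s dvd i - j \<and> s dvd j}"
        then obtain q where q: "j = s * q" by (auto elim: dvdE)
        then have qm: "q \<le> m" "0 < q" using j m pos[OF s] by (auto intro: Nat.gr0I)
        have dq: "(i - j) div s = m - q" "j div s = q" "order G div s = N"
          using q m N pos[OF s] by (simp_all flip: diff_mult_distrib2)
        show "s * (m - (m - j div s)) = j" "m - j div s \<in> {..<m}"
          "real ((N + (m - j div s) - 1) choose (m - j div s)) * (real (order G) * ramanujan_sum s g)
            = ?b s (i - j) * (real (order G) * ramanujan_sum s g)"
          unfolding dq using qm q by auto
      next
        fix k assume k: "k \<in> {..<m}"
        then show "m - s * (m - k) div s = k" using pos[OF s] by simp
        have "s * (m - k) \<le> i" "i - s * (m - k) = s * k"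
          using k m by (simp_all flip: diff_mult_distrib2)
        then show "s * (m - k) \<in> {j \<in> {1..i}. s dvd i - j \<and> s dvd j}"
          using k pos[OF s] by (auto simp: Suc_le_eq)
      qed
      \<comment> \<open>The order splits as \<open>s * N\<close>: the factor \<open>N\<close> is
        absorbed by the binomial identity, which returns \<open>m\<close>, and
        \<open>s * m = i\<close>.\<close>
      also have "\<dots> = real s * real (N * (\<Sum>k<m. (N + k - 1) choose k)) * ramanujan_sum s g"
        by (simp add: N sum_distrib_left sum_distrib_right ac_simps)
      also have "\<dots> = real i * (?b s i * ramanujan_sum s g)"
        using pos[OF s] by (simp only: sum_diagonal_binomial[OF N0]) (simp add: m N)
      finally show ?thesis using True by simp
    qed
  qed
  also have "\<dots> = real i * multiset_formula i g"
    unfolding mf by (simp add: sum_distrib_left if_distrib cong: if_cong)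
  finally show ?thesis ..
qed

lemma num_multisubsets_eq_formula:
  assumes fin: "finite (carrier G)" and "g \<in> carrier G"
  shows "real (order G) * real (num_multisubsets G (carrier G) i g) = multiset_formula i g"
  using assms(2)
proof (induction i arbitrary: g rule: less_induct)
  case (less i)
  show ?case
  proof (cases "i = 0")
    case True
    have "{A. set_mset A \<subseteq> carrier G \<and> size A = 0 \<and> mset_total G A = g} = (if g = \<one> then {{#}} else {})"
      by (auto simp: mset_total_def)
    then have "num_multisubsets G (carrier G) 0 g = (if g = \<one> then 1 else 0)"
      by (simp add: num_multisubsets_def)
    \<comment> \<open>For \<open>i = 0\<close> every divisor of the exponent occurs, with binomial
      1, so the formula reduces to \<open>num_roots (group_exponent G) g\<close>.\<close>
    moreover have "{x \<in> carrier G. x [^] group_exponent G = g} = (if g = \<one> then carrier G else {})"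
      using pow_group_exponent[OF fin] by auto
    then have "num_roots (group_exponent G) g = (if g = \<one> then order G else 0)"
      by (simp add: num_roots_def order_def)
    ultimately show ?thesis
      using True sum_ramanujan_sum[OF group_exponent_pos[OF fin], of g]
      by (simp add: multiset_formula_def)
  next
    case False
    have "real i * (real (order G) * real (num_multisubsets G (carrier G) i g))
      = real (order G) * real (i * num_multisubsets G (carrier G) i g)" by simp
    also have "\<dots> = (\<Sum>j\<in>{1..i}. \<Sum>h\<in>carrier G.
        real (order G) * real (num_multisubsets G (carrier G) (i - j) (g \<otimes> inv (h [^] j))))"
      by (subst num_multisubsets_rec[OF fin less.prems]) (simp add: sum_distrib_left)
    also have "\<dots> = (\<Sum>j\<in>{1..i}. \<Sum>h\<in>carrier G. multiset_formula (i - j) (g \<otimes> inv (h [^] j)))"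
      using less by (intro sum.cong refl less.IH) auto
    also have "\<dots> = real i * multiset_formula i g"
      by (rule multiset_formula_rec[OF fin less.prems, symmetric])
    finally show ?thesis using False by simp
  qed
qed

end

theorem theorem1:
  fixes G :: "('a, 'b) monoid_scheme" (structure) and g :: 'a and n i :: nat
  assumes "comm_group G"
    and "finite (carrier G)"
    and "order G = n"
    and "g \<in> carrier G"
  shows "real (num_multisubsets G (carrier G) i g) =
    1 / real n *
      (\<Sum>s | s dvd gcd (group_exponent G) i.
         real ((n div s + i div s - 1) choose (i div s)) *
         (\<Sum>d | d dvd gcd s (e_index G g).
            real_of_int (moebius (s div d)) * real (card (torsion G d))))"
proof -
  interpret comm_group G by fact
  have "n > 0" using assms order_gt_0_iff_finite by blast
  moreover have "(\<Sum>s | s dvd gcd (group_exponent G) i.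
         real ((n div s + i div s - 1) choose (i div s)) *
         (\<Sum>d | d dvd gcd s (e_index G g).
            real_of_int (moebius (s div d)) * real (card (torsion G d)))) = multiset_formula i g"
    unfolding multiset_formula_def using assms by (intro sum.cong) (auto simp: ramanujan_sum_eq)
  ultimately show ?thesis
    using num_multisubsets_eq_formula[OF assms(2,4), of i] assms(3) by (simp add: field_simps)
qed

end
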